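(* Let $r\geq 3$ and let $D$ be an $m$-colored semicomplete $r$-partite digraph such that every $\overrightarrow{C}_4$ contained in $D$ is at most $2$-colored, and such that either every $\overrightarrow{C}_5$ contained in $D$ is at most $3$-colored, or every $\overrightarrow{C}_3\uparrow\overrightarrow{C}_3$ contained in $D$ is at most $2$-colored. Then $D$ has a $3$-colored kernel.
   Context: A semicomplete $r$-partite digraph ($r\ge 2$) is a digraph whose vertex set is partitioned into $r$ nonempty independent sets (partite sets) such that for any two vertices $u,v$ in different partite sets at least one of the arcs $(u,v)$, $(v,u)$ is present (both may be present); there are no arcs inside a partite set. An $m$-colored digraph is a digraph whose arcs are each assigned one of $m$ colors. A directed path (no repeated vertices) is $j$-colored if its arcs use exactly $j$ distinct colors. "Contained in $D$" means being a subdigraph of $D$; a subdigraph is at most $k$-colored if its arcs use at most $k$ colors. $\overrightarrow{C}_n$ is the directed cycle of length $n$. $\overrightarrow{C}_3\uparrow\overrightarrow{C}_3$ denotes the digraph on four distinct vertices $a,b,c,d$ with arcs $a\to b$, $b\to c$, $c\to a$, $a\to d$, $d\to c$, i.e. two directed $3$-cycles $(a,b,c,a)$ and $(a,d,c,a)$ sharing exactly the arc $c\to a$. A $k$-colored kernel of $D$ is a nonempty set $K\subseteq V(D)$ such that (a) for every $u\in V(D)\setminus K$ there exist $v\in K$ and a $j$-colored directed path from $u$ to $v$ with $1\le j\le k$, and (b) for all distinct $u,v\in K$ there is no $j$-colored directed path from $u$ to $v$ with $1\le j\le k$. *)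

theory Defs
  imports Main
begin

definition semicomplete_multipartite ::
  "'a set \<Rightarrow> ('a \<times> 'a) set \<Rightarrow> nat \<Rightarrow> ('a \<Rightarrow> nat) \<Rightarrow> bool" where
  "semicomplete_multipartite V A r p \<longleftrightarrow>
     r \<ge> 2 \<and> A \<subseteq> V \<times> V \<and>
     (\<forall>v\<in>V. p v < r) \<and>
     (\<forall>i<r. \<exists>v\<in>V. p v = i) \<and>
     (\<forall>(u,v)\<in>A. p u \<noteq> p v) \<and>
     (\<forall>u\<in>V. \<forall>v\<in>V. p u \<noteq> p v \<longrightarrow> (u,v) \<in> A \<or> (v,u) \<in> A)"

definition path_colors :: "('a \<times> 'a \<Rightarrow> 'c) \<Rightarrow> 'a list \<Rightarrow> 'c set" where
  "path_colors col xs = col ` set (zip xs (tl xs))"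

definition is_dpath :: "'a set \<Rightarrow> ('a \<times> 'a) set \<Rightarrow> 'a list \<Rightarrow> bool" where
  "is_dpath V A xs \<longleftrightarrow> xs \<noteq> [] \<and> distinct xs \<and> set xs \<subseteq> V \<and>
     (\<forall>i. Suc i < length xs \<longrightarrow> (xs ! i, xs ! Suc i) \<in> A)"

definition colored_reach ::
  "'a set \<Rightarrow> ('a \<times> 'a) set \<Rightarrow> ('a \<times> 'a \<Rightarrow> 'c) \<Rightarrow> nat \<Rightarrow> 'a \<Rightarrow> 'a \<Rightarrow> bool" where
  "colored_reach V A col k u v \<longleftrightarrow>
     (\<exists>xs. is_dpath V A xs \<and> hd xs = u \<and> last xs = v \<and>
        1 \<le> card (path_colors col xs) \<and> card (path_colors col xs) \<le> k)"

definition k_colored_kernel ::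
  "'a set \<Rightarrow> ('a \<times> 'a) set \<Rightarrow> ('a \<times> 'a \<Rightarrow> 'c) \<Rightarrow> nat \<Rightarrow> 'a set \<Rightarrow> bool" where
  "k_colored_kernel V A col k K \<longleftrightarrow>
     K \<noteq> {} \<and> K \<subseteq> V \<and>
     (\<forall>u\<in>V - K. \<exists>v\<in>K. colored_reach V A col k u v) \<and>
     (\<forall>u\<in>K. \<forall>v\<in>K. u \<noteq> v \<longrightarrow> \<not> colored_reach V A col k u v)"

definition C4_at_most_2 :: "('a \<times> 'a) set \<Rightarrow> ('a \<times> 'a \<Rightarrow> 'c) \<Rightarrow> bool" where
  "C4_at_most_2 A col \<longleftrightarrow>
     (\<forall>a b c d. distinct [a,b,c,d] \<and> (a,b) \<in> A \<and> (b,c) \<in> A \<and> (c,d) \<in> A \<and> (d,a) \<in> A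
        \<longrightarrow> card {col (a,b), col (b,c), col (c,d), col (d,a)} \<le> 2)"

definition C5_at_most_3 :: "('a \<times> 'a) set \<Rightarrow> ('a \<times> 'a \<Rightarrow> 'c) \<Rightarrow> bool" where
  "C5_at_most_3 A col \<longleftrightarrow>
     (\<forall>a b c d e. distinct [a,b,c,d,e] \<and> (a,b) \<in> A \<and> (b,c) \<in> A \<and> (c,d) \<in> A
        \<and> (d,e) \<in> A \<and> (e,a) \<in> A
        \<longrightarrow> card {col (a,b), col (b,c), col (c,d), col (d,e), col (e,a)} \<le> 3)"

definition C3upC3_at_most_2 :: "('a \<times> 'a) set \<Rightarrow> ('a \<times> 'a \<Rightarrow> 'c) \<Rightarrow> bool" where
  "C3upC3_at_most_2 A col \<longleftrightarrow>
     (\<forall>a b c d. distinct [a,b,c,d] \<and> (a,b) \<in> A \<and> (b,c) \<in> A \<and> (c,a) \<in> A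
        \<and> (a,d) \<in> A \<and> (d,c) \<in> A
        \<longrightarrow> card {col (a,b), col (b,c), col (c,a), col (a,d), col (d,c)} \<le> 2)"

end

theory Submission
  imports Defs
begin

text \<open>
  Write \<open>R\<close> for reachability by at most 3-colored paths and \<open>S\<close> for its asymmetric part. If \<open>S\<close> is
  acyclic, then a kernel of \<open>R\<close> is built greedily from \<open>S\<close>-sinks, so it suffices to exclude \<open>S\<close>-cycles.
  Paths of length at most 3 are at most 3-colored; hence \<open>S u v\<close> implies that the distance from \<open>v\<close>
  to \<open>u\<close> is at least 4. Along an \<open>S\<close>-cycle \<open>u\<^sub>0, u\<^sub>1, \<dots>\<close> this yields, by induction on \<open>l\<close>, that
  \<open>u\<^sub>i\<close> dominates \<open>u\<^sub>i\<^sub>+\<^sub>l\<close> or lies in the same partite set. Going once around, the whole cycle lies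
  in one partite set. The condition on 4-cycles shows that then \<open>u\<^sub>i \<rightarrow> a \<rightarrow> u\<^sub>i\<^sub>+\<^sub>1\<close> for some \<open>a\<close>;
  moving backwards along the cycle, every \<open>u\<^sub>j\<close> dominates \<open>a\<close>, in particular \<open>u\<^sub>i\<^sub>+\<^sub>2 \<rightarrow> a \<rightarrow> u\<^sub>i\<^sub>+\<^sub>1\<close>,
  a contradiction.
\<close>

text \<open>Take \<open>x\<close> in \<open>U\<close> with no \<open>?S\<close>-successor in
  \<open>U\<close>, remove \<open>x\<close> and all vertices related to it, and add \<open>x\<close>
  to a solution for the rest. No remaining vertex reaches \<open>x\<close>, hence by the choice of
  \<open>x\<close> it reaches none of them. The arbitrary \<open>U\<close> serves the
  induction.\<close>

lemma kernel_if_asymmetric_part_acyclic: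
  fixes R :: "'a \<Rightarrow> 'a \<Rightarrow> bool"
  assumes fin: "finite V"
    and acyc: "acyclic {(x, y). x \<in> V \<and> y \<in> V \<and> R x y \<and> \<not> R y x}"
    and "U \<subseteq> V"
  shows "\<exists>K \<subseteq> U. (\<forall>u\<in>U - K. \<exists>v\<in>K. R u v) \<and> (\<forall>u\<in>K. \<forall>v\<in>K. u \<noteq> v \<longrightarrow> \<not> R u v)"
proof -
  let ?S = "{(x, y). x \<in> V \<and> y \<in> V \<and> R x y \<and> \<not> R y x}"
  have "?S \<subseteq> V \<times> V" by auto
  then have "finite ?S" using fin by (meson finite_SigmaI finite_subset)
  then have wf: "wf (?S\<inverse>)" using acyc by (rule finite_acyclic_wf_converse)
  have "finite U" using fin \<open>U \<subseteq> V\<close> finite_subset by blast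
  then show ?thesis using \<open>U \<subseteq> V\<close>
  proof (induction U rule: finite_psubset_induct)
    case (psubset U)
    show ?case
    proof (cases "U = {}")
      case True
      then show ?thesis by auto
    next
      case False
      then obtain x where "x \<in> U" and sink: "\<And>y. (y, x) \<in> ?S\<inverse> \<Longrightarrow> y \<notin> U"
        by (rule wfE_min'[OF wf]) blast
      have sym: "R y x" if "y \<in> U" "R x y" for y
        using sink[of y] that \<open>x \<in> U\<close> psubset.prems by auto
      let ?U = "{y \<in> U. y \<noteq> x \<and> \<not> R y x}"
      have "?U \<subset> U" "?U \<subseteq> V" using \<open>x \<in> U\<close> psubset.prems by auto
      then obtain K where K: "K \<subseteq> ?U" "\<forall>u\<in>?U - K. \<exists>v\<in>K. R u v"
        "\<forall>u\<in>K. \<forall>v\<in>K. u \<noteq> v \<longrightarrow> \<not> R u v"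
        using psubset.IH[of ?U] by blast
      have "insert x K \<subseteq> U" using K(1) \<open>x \<in> U\<close> by auto
      moreover have "\<forall>u\<in>U - insert x K. \<exists>v\<in>insert x K. R u v" using K(2) by blast
      moreover have "\<forall>u\<in>insert x K. \<forall>v\<in>insert x K. u \<noteq> v \<longrightarrow> \<not> R u v"
        using K(1,3) sym by blast
      ultimately show ?thesis by blast
    qed
  qed
qed

lemma periodic_sequence_if_not_acyclic:
  assumes "\<not> acyclic S"
  obtains u :: "nat \<Rightarrow> 'a" and n where "n > 0" "\<And>i. (u i, u (Suc i)) \<in> S" "\<And>i. u (i + n) = u i"
proof -
  obtain x n where "n > 0" "(x, x) \<in> S ^^ n"
    using assms unfolding acyclic_def trancl_power by blast
  then obtain f where f: "f 0 = x" "f n = x" "\<forall>i<n. (f i, f (Suc i)) \<in> S"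
    unfolding relpow_fun_conv by blast
  have "(f (i mod n), f (Suc i mod n)) \<in> S" for i
  proof -
    \<comment> \<open>At the wrap-around \<open>i mod n = n - 1\<close> this needs
      \<open>f 0 = f n\<close>.\<close>
    have "f (Suc i mod n) = f (Suc (i mod n))" using f(1,2) by (simp add: mod_Suc)
    then show ?thesis using f(3) \<open>n > 0\<close> by simp
  qed
  then show thesis using that[of n "\<lambda>i. f (i mod n)"] \<open>n > 0\<close> by simp
qed

section \<open>Paths with few colors\<close>

lemma colored_reach_imp_rtrancl:
  assumes "colored_reach V A col k u v"
  shows "(u, v) \<in> A\<^sup>*"
proof -
  obtain xs where xs: "xs \<noteq> []" "hd xs = u" "last xs = v"
    "\<forall>i. Suc i < length xs \<longrightarrow> (xs ! i, xs ! Suc i) \<in> A"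
    using assms unfolding colored_reach_def is_dpath_def by blast
  have "i < length xs \<Longrightarrow> (xs ! 0, xs ! i) \<in> A\<^sup>*" for i
    by (induction i) (use xs(4) in \<open>auto intro: rtrancl_into_rtrancl\<close>)
  then have "(xs ! 0, xs ! (length xs - 1)) \<in> A\<^sup>*" using xs(1) by simp
  then show ?thesis using xs by (simp add: hd_conv_nth last_conv_nth)
qed

lemma is_dpath_singleton: "is_dpath V A [x] \<longleftrightarrow> x \<in> V"
  unfolding is_dpath_def by simp

lemma is_dpath_Cons_Cons:
  "is_dpath V A (x # y # ys) \<longleftrightarrow>
    x \<in> V \<and> (x, y) \<in> A \<and> x \<notin> set (y # ys) \<and> is_dpath V A (y # ys)"
proof -
  have "(\<forall>i. Suc i < length (x # y # ys) \<longrightarrow> ((x # y # ys) ! i, (x # y # ys) ! Suc i) \<in> A) \<longleftrightarrow>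
      (x, y) \<in> A \<and> (\<forall>i. Suc i < length (y # ys) \<longrightarrow> ((y # ys) ! i, (y # ys) ! Suc i) \<in> A)"
    (is "?L \<longleftrightarrow> ?R")
  proof
    assume ?L
    from spec[OF this, of 0] spec[OF this, of "Suc _"] show ?R by auto
  next
    assume ?R
    show ?L
    proof
      fix i
      show "Suc i < length (x # y # ys) \<longrightarrow> ((x # y # ys) ! i, (x # y # ys) ! Suc i) \<in> A"
        using \<open>?R\<close> by (cases i) auto
    qed
  qed
  then show ?thesis unfolding is_dpath_def by auto
qed

lemmas is_dpath_simps = is_dpath_singleton is_dpath_Cons_Cons

lemma card_triple_le: "card {a, b, c} \<le> 3"
  by (simp add: card_insert_if)

locale multipartite =
  fixes V :: "'a set" and A :: "('a \<times> 'a) set" and p :: "'a \<Rightarrow> nat" and col :: "'a \<times> 'a \<Rightarrow> nat"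
  assumes arcs: "A \<subseteq> V \<times> V"
    and arc_parts: "(u, v) \<in> A \<Longrightarrow> p u \<noteq> p v"
    and semicomplete: "u \<in> V \<Longrightarrow> v \<in> V \<Longrightarrow> p u \<noteq> p v \<Longrightarrow> (u, v) \<in> A \<or> (v, u) \<in> A"
begin

abbreviation R :: "'a \<Rightarrow> 'a \<Rightarrow> bool" where
  "R \<equiv> colored_reach V A col 3"

definition S :: "'a rel" where
  "S = {(u, v). u \<in> V \<and> v \<in> V \<and> R u v \<and> \<not> R v u}"

lemma reach1:
  assumes "(u, v) \<in> A"
  shows "R u v"
  unfolding colored_reach_def path_colors_def
  using assms arcs arc_parts[OF assms] by (intro exI[of _ "[u, v]"]) (auto simp: is_dpath_simps)

lemma reach2:
  assumes "(u, a) \<in> A" "(a, v) \<in> A" "u \<noteq> v"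
  shows "R u v"
proof -
  have "u \<noteq> a" "a \<noteq> v" using assms(1,2) arc_parts by blast+
  moreover have "card {col (u, a), col (a, v)} \<le> 3"
    using card_triple_le[of "col (u, a)" "col (a, v)" "col (a, v)"] by simp
  ultimately show ?thesis
    unfolding colored_reach_def path_colors_def
    using assms arcs by (intro exI[of _ "[u, a, v]"])
      (auto simp: is_dpath_simps Suc_le_eq card_gt_0_iff)
qed

lemma reach3:
  assumes "(u, a) \<in> A" "(a, b) \<in> A" "(b, v) \<in> A" "u \<noteq> v"
  shows "R u v"
proof (cases "a = v \<or> b = u")
  case True
  then show ?thesis using assms reach1 by blast
next
  case False
  have "u \<noteq> a" "a \<noteq> b" "b \<noteq> v" using assms(1-3) arc_parts by blast+
  then show ?thesis
    unfolding colored_reach_def path_colors_def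
    using assms arcs False card_triple_le[of "col (u, a)" "col (a, b)" "col (b, v)"]
    by (intro exI[of _ "[u, a, b, v]"]) (auto simp: is_dpath_simps Suc_le_eq card_gt_0_iff)
qed

text \<open>The last three arcs will lie on a 4-cycle, hence carry at most two colors; the first arc
  adds at most one.\<close>

lemma reach4:
  assumes "(u, a) \<in> A" "(a, b) \<in> A" "(b, c) \<in> A" "(c, v) \<in> A" "distinct [u, a, b, c, v]"
    and "card {col (a, b), col (b, c), col (c, v)} \<le> 2"
  shows "R u v"
proof -
  have "card {col (u, a), col (a, b), col (b, c), col (c, v)} \<le> 3"
    using assms(6) card_insert_le_m1[of 3 "{col (a, b), col (b, c), col (c, v)}" "col (u, a)"] by simp
  then show ?thesis
    unfolding colored_reach_def path_colors_def
    using assms(1-5) arcs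
    by (intro exI[of _ "[u, a, b, c, v]"]) (auto simp: is_dpath_simps Suc_le_eq card_gt_0_iff)
qed

section \<open>Cycles of the asymmetric part \<open>S\<close>\<close>

lemma S_memD:
  assumes "(u, v) \<in> S"
  shows "u \<in> V" "v \<in> V" "R u v" "\<not> R v u" "u \<noteq> v"
  using assms unfolding S_def by auto

lemma S_arc:
  assumes "(u, v) \<in> S" "p u \<noteq> p v"
  shows "(u, v) \<in> A"
  using S_memD[OF assms(1)] assms(2) semicomplete reach1 by blast

text \<open>
  If there is no such \<open>w\<close>, then \<open>u\<close> and \<open>v\<close> are twins: the vertices outside their partite set split
  into common out-neighbours \<open>Out\<close> and common in-neighbours. A shortest path from \<open>Out\<close> to the
  in-neighbours has an inner vertex in the partite set of \<open>u\<close> and closes to a 4-cycle through \<open>u\<close>.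
\<close>

lemma S_same_part_length_2:
  assumes C4: "C4_at_most_2 A col"
    and S: "(u, v) \<in> S" and same: "p u = p v"
  obtains w where "(u, w) \<in> A" "(w, v) \<in> A"
proof (rule ccontr)
  assume "\<not> thesis"
  then have no_uv: "\<not> ((u, w) \<in> A \<and> (w, v) \<in> A)" for w using that by blast
  note uv = S_memD[OF S]
  have no_vu: "\<not> ((v, w) \<in> A \<and> (w, u) \<in> A)" for w using reach2 uv by metis
  define Out where "Out = {w. (u, w) \<in> A \<and> (v, w) \<in> A}"
  have out_or_in: "w \<in> Out \<or> (w, u) \<in> A \<and> (w, v) \<in> A" if "w \<in> V" "p w \<noteq> p u" for w
    using semicomplete[of u w] semicomplete[of v w] that same uv(1,2) no_uv[of w] no_vu[of w]
    unfolding Out_def by auto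
  have Out_not_back: "(w, u) \<notin> A" "(w, v) \<notin> A" if "w \<in> Out" for w
    using that no_uv no_vu unfolding Out_def by auto
  have no_step: "y \<in> Out" if "x \<in> Out" "(x, y) \<in> A" "p y \<noteq> p u" for x y
  proof (rule ccontr)
    assume "y \<notin> Out"
    then have "(y, u) \<in> A" using out_or_in[of y] that arcs by auto
    then have "R v u" using reach3[of v x y u] that uv(5) unfolding Out_def by auto
    then show False using uv(4) by blast
  qed
  have no_detour: "y \<in> Out" if x: "x \<in> Out" "(x, z) \<in> A" "p z = p u" and z: "(z, y) \<in> A" for x y z
  proof (rule ccontr)
    assume y: "y \<notin> Out"
    have "p y \<noteq> p u" using arc_parts[OF z] x(3) by simp
    then have yu: "(y, u) \<in> A" "(y, v) \<in> A" using out_or_in[of y] z y arcs by auto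
    have xs: "(u, x) \<in> A" "(v, x) \<in> A" using x(1) unfolding Out_def by auto
    have "z \<noteq> u" "z \<noteq> v" using Out_not_back[OF x(1)] x(2) by auto
    moreover have "p x \<noteq> p u" "p y \<noteq> p u" "x \<noteq> y"
      using arc_parts[OF xs(1)] arc_parts[OF yu(1)] x(1) y by auto
    ultimately have dist: "distinct [v, x, z, y, u]" "distinct [u, x, z, y]"
      using uv(5) same x(3) by auto
    have "card {col (u, x), col (x, z), col (z, y), col (y, u)} \<le> 2"
      using C4 dist(2) xs(1) x(2) z yu(1) unfolding C4_at_most_2_def by blast
    moreover have "card {col (x, z), col (z, y), col (y, u)}
        \<le> card {col (u, x), col (x, z), col (z, y), col (y, u)}"
      by (rule card_mono) auto
    ultimately have "R v u"
      using reach4[of v x z y u] xs(2) x(2) z yu(1) dist(1) by linarith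
    then show False using uv(4) by blast
  qed
  \<comment> \<open>\<open>W\<close> turns the shortest-path argument into a closure argument: it
    contains \<open>u\<close> and is closed under arcs, so it must contain \<open>v\<close>, which
    is impossible.\<close>
  define W where "W = insert u (Out \<union> {z. p z = p u \<and> (\<exists>x\<in>Out. (x, z) \<in> A)})"
  have closed: "y \<in> W" if "z \<in> W" "(z, y) \<in> A" for z y
  proof -
    have "y \<in> Out" if "z = u"
    proof -
      have "p y \<noteq> p u" "y \<in> V" "(u, y) \<in> A" using that \<open>(z, y) \<in> A\<close> arc_parts[of z y] arcs by auto
      then show ?thesis using out_or_in[of y] no_uv[of y] by blast
    qed
    moreover have "y \<in> W" if "z \<in> Out"
      using no_step[OF that \<open>(z, y) \<in> A\<close>] that \<open>(z, y) \<in> A\<close> unfolding W_def by blast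
    ultimately show ?thesis using no_detour that unfolding W_def by blast
  qed
  have "(u, v) \<in> A\<^sup>*" using colored_reach_imp_rtrancl uv(3) .
  moreover have "u \<in> W" unfolding W_def by simp
  ultimately have "v \<in> W" by (induction rule: rtrancl_induct) (blast intro: closed)+
  then have "v \<in> Out" using uv(5) Out_not_back unfolding W_def by auto
  then show False using arc_parts same unfolding Out_def by blast
qed

text \<open>An arc from \<open>u (i + l)\<close> to \<open>u i\<close> extends shorter dominations
  to a path of length 2 or 3 that reverses an \<open>S\<close>-step: via \<open>u (i + 1)\<close> to
  \<open>u (i + l)\<close>, via \<open>u i\<close> to \<open>u (i + l - 1)\<close>, or, if both
  pairs share a part, via \<open>u (i + 1)\<close> to \<open>u (i + l - 1)\<close> to
  \<open>u (i + l)\<close>.\<close>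

lemma S_sequence_dominates:
  assumes S: "\<And>i. (u i, u (Suc i)) \<in> S"
    and "l > 0"
  shows "p (u i) \<noteq> p (u (i + l)) \<Longrightarrow> (u i, u (i + l)) \<in> A"
  using \<open>l > 0\<close>
proof (induction l arbitrary: i rule: less_induct)
  case (less l)
  note no_back = S_memD(4)[OF S] and neq = S_memD(5)[OF S]
  show ?case
  proof (cases "l = 1")
    case True
    then show ?thesis using S_arc S less.prems by simp
  next
    case False
    with less.prems obtain k where l: "l = Suc k" "k > 0" by (cases l) auto
    show ?thesis
    proof (rule ccontr)
      assume "(u i, u (i + l)) \<notin> A"
      then have rev_arc: "(u (Suc (i + k)), u i) \<in> A"
        using semicomplete less.prems S_memD(1)[OF S] l by force
      have "(u (Suc i), u (Suc (i + k))) \<notin> A"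
        using reach2[OF _ rev_arc] no_back neq[of i] by metis
      then have Q: "p (u (Suc i)) = p (u (Suc (i + k)))"
        using less.IH[of k "Suc i"] l by auto
      have "(u i, u (i + k)) \<notin> A"
        using reach2[OF rev_arc] no_back neq[of "i + k"] by metis
      then have P: "p (u i) = p (u (i + k))"
        using less.IH[of k i] l by auto
      have PQ: "p (u i) \<noteq> p (u (Suc (i + k)))" using arc_parts[OF rev_arc] by simp
      then have "k \<noteq> 1" using P Q by auto
      then obtain j where k: "k = Suc j" "j > 0" using l(2) by (cases k) auto
      have "(u (Suc i), u (i + k)) \<in> A"
        using less.IH[of j "Suc i"] k l P Q PQ by auto
      moreover have "(u (i + k), u (Suc (i + k))) \<in> A" using S_arc[OF S] P PQ by simp
      ultimately show False using reach3[OF _ _ rev_arc] no_back neq[of i] by metis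
    qed
  qed
qed

lemma acyclic_S:
  assumes C4: "C4_at_most_2 A col"
  shows "acyclic S"
proof (rule ccontr)
  assume "\<not> acyclic S"
  then obtain u n where n: "n > (0::nat)" and S: "\<And>i. (u i, u (Suc i)) \<in> S"
    and per: "\<And>i. u (i + n) = u i"
    by (rule periodic_sequence_if_not_acyclic) blast
  note uV = S_memD(1)[OF S] and no_back = S_memD(4)[OF S] and neq = S_memD(5)[OF S]
  have "n \<noteq> 1" using per[of 0] neq[of 0] by auto
  then obtain k where k: "n = Suc k" "k > 0" using n by (cases n) auto
  have same: "p (u (Suc i)) = p (u i)" for i
  proof (rule ccontr)
    assume "p (u (Suc i)) \<noteq> p (u i)"
    \<comment> \<open>The remaining \<open>k = n - 1\<close> steps of the cycle lead from
      \<open>u (Suc i)\<close> back to \<open>u i\<close>, so domination gives an arc against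
      \<open>S\<close>.\<close>
    moreover have "u (Suc i + k) = u i" using per[of i] k by simp
    ultimately have "(u (Suc i), u i) \<in> A"
      using S_sequence_dominates[of u k "Suc i"] S k by simp
    then show False using reach1 no_back by blast
  qed
  have part: "p (u i) = p (u 0)" for i by (induction i) (simp_all add: same)
  \<comment> \<open>Index \<open>n\<close> rather than 0 leaves room for the descent along
    \<open>n - i\<close>.\<close>
  obtain a where a: "(u n, a) \<in> A" "(a, u (Suc n)) \<in> A"
    using S_same_part_length_2[OF C4 S[of n]] same by metis
  have "(u (n - i), a) \<in> A" if "i \<le> n" for i
    using that
  proof (induction i)
    case 0
    then show ?case using a by simp
  next
    case (Suc i)
    define j where "j = n - Suc i"
    have "(u (Suc j), a) \<in> A" using Suc unfolding j_def by (simp add: Suc_diff_Suc)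
    \<comment> \<open>Otherwise \<open>u (Suc j)\<close> reaches \<open>u j\<close> through
      \<open>a\<close>.\<close>
    then have "(a, u j) \<notin> A" using reach2 no_back neq by metis
    moreover have "p (u j) \<noteq> p a" using arc_parts[OF a(1)] part by metis
    ultimately show ?case using semicomplete[of "u j" a] uV a(1) arcs unfolding j_def by blast
  qed
  \<comment> \<open>Here \<open>n - (k - 1) = 2\<close>, and \<open>u (Suc n)\<close> is
    \<open>u 1\<close> by periodicity.\<close>
  from this[of "k - 1"] have "(u 2, a) \<in> A" using k by (simp add: numeral_2_eq_2)
  moreover have "(a, u 1) \<in> A" using a(2) per[of 1] by simp
  ultimately have "R (u 2) (u 1)" using reach2 neq[of 1] by (metis Suc_1)
  then show False using no_back[of 1] by (simp add: numeral_2_eq_2)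
qed

end

theorem mainTheorem7:
  fixes V :: "'a set" and A :: "('a \<times> 'a) set" and r m :: nat
    and p :: "'a \<Rightarrow> nat" and col :: "'a \<times> 'a \<Rightarrow> nat"
  assumes "finite V"
    and "r \<ge> 3"
    and "semicomplete_multipartite V A r p"
    and "\<forall>e\<in>A. col e < m"
    and "C4_at_most_2 A col"
    and "C5_at_most_3 A col \<or> C3upC3_at_most_2 A col"
  shows "\<exists>K. k_colored_kernel V A col 3 K"
proof -
  interpret multipartite V A p col
    using assms(3) unfolding semicomplete_multipartite_def by unfold_locales auto
  have "V \<noteq> {}" using assms(2,3) unfolding semicomplete_multipartite_def by force
  obtain K where K: "K \<subseteq> V" "\<forall>u\<in>V - K. \<exists>v\<in>K. R u v" "\<forall>u\<in>K. \<forall>v\<in>K. u \<noteq> v \<longrightarrow> \<not> R u v"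
    using kernel_if_asymmetric_part_acyclic[OF assms(1) acyclic_S[OF assms(5), unfolded S_def] subset_refl]
    by blast
  then have "K \<noteq> {}" using \<open>V \<noteq> {}\<close> by auto
  then show ?thesis using K unfolding k_colored_kernel_def by blast
qed

end
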